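(* Let $X$ be a real Banach space and let $G\leqslant \mathrm{GL}(X)$ be a group of isomorphisms of $X$. If $X$ admits a $G$-invariant renorming which is LUR on a dense subset of the unit sphere $S_X$, then $G$ is light.
   Context: $\mathrm{GL}(X)$ is the group of bounded linear isomorphisms of $X$ onto itself. A renorming of $X$ is a norm on $X$ equivalent to the given one; it is $G$-invariant if $\|Tx\|=\|x\|$ for all $T\in G$, $x\in X$; $S_X$ is the unit sphere for the norm under consideration. A norm $\|\cdot\|$ is LUR (locally uniformly rotund) at $x_0\in X$ if, whenever $(x_n)$ is a sequence in $X$ with $\lim\|x_n\|=\|x_0\|$ and $\lim\|x_0+x_n\|=2\|x_0\|$, one has $\lim\|x_n-x_0\|=0$. The Strong Operator Topology (SOT) is the topology of pointwise norm convergence on $X$; the Weak Operator Topology (WOT) is the topology generated by the maps $T\mapsto x^*(Tx)$, $x\in X$, $x^*\in X^*$. A group $G\leqslant\mathrm{GL}(X)$ is light if the WOT and the SOT coincide on $G$. *)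

theory Defs
  imports "HOL-Analysis.Analysis" "HOL-Algebra.Group"
begin

definition GL :: "('a::real_normed_vector \<Rightarrow>\<^sub>L 'a) monoid" where
  "GL = \<lparr>carrier = {T. \<exists>S. S o\<^sub>L T = id_blinfun \<and> T o\<^sub>L S = id_blinfun},
         mult = (o\<^sub>L), one = id_blinfun\<rparr>"

lemma group_GL: "group GL"
proof (rule groupI)
  fix T S :: "'a \<Rightarrow>\<^sub>L 'a"
  assume T: "T \<in> carrier GL" and S: "S \<in> carrier GL"
  obtain T' where T': "T' o\<^sub>L T = id_blinfun" "T o\<^sub>L T' = id_blinfun"
    using T by (auto simp: GL_def)
  obtain S' where S': "S' o\<^sub>L S = id_blinfun" "S o\<^sub>L S' = id_blinfun"
    using S by (auto simp: GL_def)
  have t: "T' (T x) = x" "T (T' x) = x" "S' (S x) = x" "S (S' x) = x" for x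
    using T' S' by (metis blinfun_apply_blinfun_compose blinfun_apply_id_blinfun id_apply)+
  have "(S' o\<^sub>L T') o\<^sub>L (T o\<^sub>L S) = id_blinfun" "(T o\<^sub>L S) o\<^sub>L (S' o\<^sub>L T') = id_blinfun"
    by (auto intro!: blinfun_eqI simp: t)
  then show "T \<otimes>\<^bsub>GL\<^esub> S \<in> carrier GL"
    by (auto simp: GL_def)
next
  have "id_blinfun o\<^sub>L id_blinfun = (id_blinfun :: 'a \<Rightarrow>\<^sub>L 'a)"
    by (auto intro: blinfun_eqI)
  then show "\<one>\<^bsub>GL\<^esub> \<in> carrier (GL :: ('a \<Rightarrow>\<^sub>L 'a) monoid)"
    by (auto simp: GL_def)
next
  fix T :: "'a \<Rightarrow>\<^sub>L 'a"
  assume "T \<in> carrier GL"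
  then show "\<exists>S\<in>carrier GL. S \<otimes>\<^bsub>GL\<^esub> T = \<one>\<^bsub>GL\<^esub>"
    by (auto simp: GL_def)
qed (auto simp: GL_def intro: blinfun_eqI)

definition is_norm :: "('a::real_vector \<Rightarrow> real) \<Rightarrow> bool" where
  "is_norm N \<longleftrightarrow>
     (\<forall>x. 0 \<le> N x) \<and> (\<forall>x. N x = 0 \<longleftrightarrow> x = 0) \<and>
     (\<forall>c x. N (c *\<^sub>R x) = \<bar>c\<bar> * N x) \<and> (\<forall>x y. N (x + y) \<le> N x + N y)"

definition renorming :: "('a::real_normed_vector \<Rightarrow> real) \<Rightarrow> bool" where
  "renorming N \<longleftrightarrow>
     is_norm N \<and> (\<exists>a>0. \<exists>b>0. \<forall>x. a * norm x \<le> N x \<and> N x \<le> b * norm x)"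

definition invariant_under ::
    "('a::real_normed_vector \<Rightarrow>\<^sub>L 'a) set \<Rightarrow> ('a \<Rightarrow> real) \<Rightarrow> bool" where
  "invariant_under G N \<longleftrightarrow> (\<forall>T\<in>G. \<forall>x. N (blinfun_apply T x) = N x)"

definition LUR_at :: "('a::real_vector \<Rightarrow> real) \<Rightarrow> 'a \<Rightarrow> bool" where
  "LUR_at N x0 \<longleftrightarrow>
     (\<forall>x :: nat \<Rightarrow> 'a.
        (\<lambda>n. N (x n)) \<longlonglongrightarrow> N x0 \<longrightarrow>
        (\<lambda>n. N (x0 + x n)) \<longlonglongrightarrow> 2 * N x0 \<longrightarrow>
        (\<lambda>n. N (x n - x0)) \<longlonglongrightarrow> 0)"

definition unit_sphere :: "('a \<Rightarrow> real) \<Rightarrow> 'a set" where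
  "unit_sphere N = {x. N x = 1}"

text \<open>
  Density is expressed with the closure for the original norm; a renorming is an
  equivalent norm and so induces the same topology.
\<close>
definition LUR_on_dense_subset_of_sphere :: "('a::real_normed_vector \<Rightarrow> real) \<Rightarrow> bool" where
  "LUR_on_dense_subset_of_sphere N \<longleftrightarrow>
     (\<exists>D \<subseteq> unit_sphere N. unit_sphere N \<subseteq> closure D \<and> (\<forall>x\<in>D. LUR_at N x))"

definition weak_operator_topology ::
    "('a::real_normed_vector \<Rightarrow>\<^sub>L 'b::real_normed_vector) topology" where
  "weak_operator_topology =
     topology_generated_by
       {{T. blinfun_apply f (blinfun_apply T x) \<in> U} |
          (f :: 'b \<Rightarrow>\<^sub>L real) x U. open U}"

definition light :: "('a::real_normed_vector \<Rightarrow>\<^sub>L 'a) set \<Rightarrow> bool" where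
  "light G \<longleftrightarrow>
     subtopology weak_operator_topology G = subtopology strong_operator_topology G"

end

theory Submission imports Defs begin

text \<open>
  For \<open>T\<^sub>0 \<in> G\<close> and a unit vector \<open>x\<close> at which the invariant norm \<open>N\<close> is LUR, Hahn--Banach gives a
  functional \<open>f \<le> N\<close> with \<open>f (T\<^sub>0 x) = 1\<close>. If \<open>T \<in> G\<close> is WOT-close to \<open>T\<^sub>0\<close>, then \<open>f (T x)\<close> is close
  to \<open>1\<close>, so \<open>N (T\<^sub>0\<inverse> T x + x) = N (T x + T\<^sub>0 x) \<ge> f (T x + T\<^sub>0 x)\<close> is close to \<open>2\<close>, and LUR at \<open>x\<close>
  makes \<open>N (T\<^sub>0\<inverse> T x - x) = N (T x - T\<^sub>0 x)\<close> small. Since \<open>G\<close> acts by \<open>N\<close>-isometries, smallness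
  passes from a dense set of unit vectors to all of them. The Hahn--Banach functional is obtained
  as a pointwise minimal sublinear functional.
\<close>

section \<open>Sublinear functionals and the Hahn--Banach theorem\<close>

definition sublinear :: "('a::real_vector \<Rightarrow> real) \<Rightarrow> bool" where
  "sublinear p \<longleftrightarrow>
     (\<forall>x y. p (x + y) \<le> p x + p y) \<and> (\<forall>c>0. \<forall>x. p (c *\<^sub>R x) \<le> c * p x)"

lemma sublinear_add: "sublinear p \<Longrightarrow> p (x + y) \<le> p x + p y"
  by (simp add: sublinear_def)

lemma sublinear_zero:
  assumes "sublinear p"
  shows "p 0 = 0"
proof -
  have "p (2 *\<^sub>R 0) \<le> 2 * p 0" "p ((1/2) *\<^sub>R 0) \<le> (1/2) * p 0"
    using assms unfolding sublinear_def by (meson half_gt_zero zero_less_numeral zero_less_one)+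
  then show ?thesis by simp
qed

text \<open>The inequality for the factor \<open>inverse c\<close>, applied at the vector
  \<open>c *\<^sub>R x\<close>, is the reverse of the defining inequality for
  \<open>c\<close>.\<close>

lemma sublinear_scaleR:
  assumes "sublinear p" "0 \<le> c"
  shows "p (c *\<^sub>R x) = c * p x"
proof (cases "c = 0")
  case False
  then have c: "c > 0" using assms by simp
  have "p (inverse c *\<^sub>R (c *\<^sub>R x)) \<le> inverse c * p (c *\<^sub>R x)"
    using assms c unfolding sublinear_def by (meson positive_imp_inverse_positive)
  then have "c * p x \<le> p (c *\<^sub>R x)" using c by (simp add: field_simps)
  moreover have "p (c *\<^sub>R x) \<le> c * p x" using assms c by (simp add: sublinear_def)
  ultimately show ?thesis by simp
qed (simp add: sublinear_zero assms)

lemma sublinear_minus: "sublinear p \<Longrightarrow> - p (- x) \<le> p x"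
  using sublinear_add[of p x "- x"] sublinear_zero[of p] by simp

text \<open>In a chain any two members \<open>q\<close>, \<open>r\<close> lie above a common member
  \<open>m\<close>, whose subadditivity bounds the infimum at \<open>x + y\<close> by
  \<open>q x + r y\<close>. The bound \<open>b\<close> keeps the pointwise infima finite.\<close>

lemma sublinear_Inf_chain:
  assumes "C \<noteq> {}" and sub: "\<And>q. q \<in> C \<Longrightarrow> sublinear q"
    and lower: "\<And>q x. q \<in> C \<Longrightarrow> b x \<le> q x"
    and chain: "\<And>q r. q \<in> C \<Longrightarrow> r \<in> C \<Longrightarrow> q \<le> r \<or> r \<le> q"
  shows "sublinear (\<lambda>x. INF q\<in>C. q x)"
proof -
  have bdd: "bdd_below ((\<lambda>q. q x) ` C)" for x
    using lower by (rule bdd_belowI2)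
  have le: "(INF q\<in>C. q x) \<le> q x" if "q \<in> C" for q x
    using bdd that by (rule cINF_lower)
  show ?thesis
    unfolding sublinear_def
  proof (intro conjI allI impI)
    fix x y
    have *: "(INF q\<in>C. q (x + y)) \<le> q x + r y" if "q \<in> C" "r \<in> C" for q r
    proof -
      obtain m where m: "m \<in> C" "m \<le> q" "m \<le> r"
        using chain[of q r] \<open>q \<in> C\<close> \<open>r \<in> C\<close> by blast
      have "(INF q\<in>C. q (x + y)) \<le> m (x + y)" using le m by blast
      also have "\<dots> \<le> m x + m y" using sub m sublinear_add by blast
      also have "\<dots> \<le> q x + r y" using m by (intro add_mono) (auto simp: le_fun_def)
      finally show ?thesis .
    qed
    have "(INF q\<in>C. q (x + y)) - r y \<le> (INF q\<in>C. q x)" if "r \<in> C" for r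
      using *[OF _ that] by (intro cINF_greatest assms(1)) (simp add: algebra_simps)
    then have "(INF q\<in>C. q (x + y)) - (INF q\<in>C. q x) \<le> (INF q\<in>C. q y)"
      by (intro cINF_greatest assms(1)) (simp add: algebra_simps)
    then show "(INF q\<in>C. q (x + y)) \<le> (INF q\<in>C. q x) + (INF q\<in>C. q y)" by simp
  next
    fix c :: real and x assume c: "c > 0"
    have "(INF q\<in>C. q (c *\<^sub>R x)) / c \<le> (INF q\<in>C. q x)"
    proof (intro cINF_greatest assms(1))
      fix q assume q: "q \<in> C"
      have "(INF q\<in>C. q (c *\<^sub>R x)) \<le> q (c *\<^sub>R x)" using le q by blast
      also have "\<dots> = c * q x" using sublinear_scaleR sub q c by (metis less_imp_le)
      finally show "(INF q\<in>C. q (c *\<^sub>R x)) / c \<le> q x" using c by (simp add: field_simps)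
    qed
    then show "(INF q\<in>C. q (c *\<^sub>R x)) \<le> c * (INF q\<in>C. q x)" using c by (simp add: field_simps)
  qed
qed

text \<open>Lowers \<open>p\<close> along \<open>x\<close>: the third property at
  \<open>y = - x\<close> gives \<open>q (- x) \<le> - p x\<close>. The witness is an infimum over
  \<open>t \<ge> 0\<close>, where \<open>t = 0\<close> yields \<open>q \<le> p\<close> and
  \<open>t = 1\<close> yields the third property.\<close>

lemma sublinear_shrink:
  assumes p: "sublinear p"
  obtains q where "sublinear q" "q \<le> p" "\<And>y. q y \<le> p (y + x) - p x"
proof -
  define q where "q y = (INF t\<in>{0..}. p (y + t *\<^sub>R x) - t * p x)" for y
  \<comment> \<open>The infimum is finite because \<open>t * p x = p (t *\<^sub>R x) \<le> p (y + t
    *\<^sub>R x) + p (- y)\<close>.\<close>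
  have "- p (- y) \<le> p (y + t *\<^sub>R x) - t * p x" if "0 \<le> t" for y t
    using sublinear_add[OF p, of "y + t *\<^sub>R x" "- y"] sublinear_scaleR[OF p that, of x] by simp
  then have bdd: "bdd_below ((\<lambda>t. p (y + t *\<^sub>R x) - t * p x) ` {0..})" for y
    by (auto intro!: bdd_belowI2)
  have le: "q y \<le> p (y + t *\<^sub>R x) - t * p x" if "0 \<le> t" for y t
    unfolding q_def using bdd that by (intro cINF_lower) auto
  have ge: "b \<le> q y" if "\<And>t. 0 \<le> t \<Longrightarrow> b \<le> p (y + t *\<^sub>R x) - t * p x" for b y
    unfolding q_def using that by (intro cINF_greatest) auto
  show thesis
  proof
    show "sublinear q"
      unfolding sublinear_def
    proof (intro conjI allI impI)
      fix y z
      \<comment> \<open>Parameters \<open>s\<close> for \<open>y\<close> and \<open>t\<close> for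
        \<open>z\<close> combine to the parameter \<open>s + t\<close> for
        \<open>y + z\<close>.\<close>
      have *: "q (y + z) \<le> (p (y + s *\<^sub>R x) - s * p x) + (p (z + t *\<^sub>R x) - t * p x)"
        if "0 \<le> s" "0 \<le> t" for s t
        using le[of "s + t" "y + z"] sublinear_add[OF p, of "y + s *\<^sub>R x" "z + t *\<^sub>R x"] that
        by (simp add: algebra_simps)
      have "q (y + z) - (p (z + t *\<^sub>R x) - t * p x) \<le> q y" if "0 \<le> t" for t
        using * that by (intro ge) (simp add: algebra_simps)
      then have "q (y + z) - q y \<le> q z"
        by (intro ge) (simp add: algebra_simps)
      then show "q (y + z) \<le> q y + q z" by simp
    next
      fix c :: real and y assume c: "c > 0"
      have "q (c *\<^sub>R y) / c \<le> q y"
      proof (rule ge)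
        fix t :: real assume t: "0 \<le> t"
        have "q (c *\<^sub>R y) \<le> p (c *\<^sub>R (y + t *\<^sub>R x)) - (c * t) * p x"
          using le[of "c * t" "c *\<^sub>R y"] c t by (simp add: algebra_simps)
        also have "\<dots> = c * (p (y + t *\<^sub>R x) - t * p x)"
          using sublinear_scaleR[OF p, of c "y + t *\<^sub>R x"] c by (simp add: algebra_simps)
        finally show "q (c *\<^sub>R y) / c \<le> p (y + t *\<^sub>R x) - t * p x" using c by (simp add: field_simps)
      qed
      then show "q (c *\<^sub>R y) \<le> c * q y" using c by (simp add: field_simps)
    qed
    show "q \<le> p" using le[of 0] by (simp add: le_fun_def)
    show "q y \<le> p (y + x) - p x" for y using le[of 1 y] by simp
  qed
qed

text \<open>Shrinking a minimal \<open>p\<close> along any \<open>x\<close> changes nothing, so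
  \<open>p y + p x \<le> p (y + x)\<close>. Additivity then gives oddness, which extends homogeneity
  to negative scalars.\<close>

lemma minimal_sublinear_linear:
  assumes p: "sublinear p" and minimal: "\<And>q. sublinear q \<Longrightarrow> q \<le> p \<Longrightarrow> q = p"
  shows "linear p"
proof -
  have add: "p (y + x) = p y + p x" for x y
  proof -
    obtain q where "sublinear q" "q \<le> p" "\<And>y. q y \<le> p (y + x) - p x"
      using sublinear_shrink[OF p] by metis
    then have "p y \<le> p (y + x) - p x" using minimal by metis
    then show ?thesis using sublinear_add[OF p, of y x] by simp
  qed
  have neg: "p (- x) = - p x" for x
    using add[of x "- x"] sublinear_zero[OF p] by simp
  have "p (c *\<^sub>R x) = c * p x" for c x
    using sublinear_scaleR[OF p, of c x] sublinear_scaleR[OF p, of "- c" x] neg[of "c *\<^sub>R x"]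
    by (cases "0 \<le> c") auto
  with add show ?thesis by (intro linearI) auto
qed

lemma ex_linear_below_sublinear:
  assumes p: "sublinear p"
  shows "\<exists>f. linear f \<and> f \<le> p"
proof -
  define A where "A = {q. sublinear q \<and> q \<le> p}"
  have "\<exists>m\<in>A. \<forall>q\<in>A. q \<le> m \<longrightarrow> q = m"
  \<comment> \<open>The order is reversed, so that a maximal element for Zorn is a minimal
    functional and chains need lower bounds.\<close>
  proof (rule predicate_Zorn)
    show "partial_order_on A (relation_of (\<lambda>q r. r \<le> q) A)"
      by (auto simp: partial_order_on_def preorder_on_def refl_on_def trans_def antisym_def
          relation_of_def)
  next
    fix C assume C: "C \<in> Chains (relation_of (\<lambda>q r. r \<le> q) A)"
    then have CA: "q \<in> A" if "q \<in> C" for q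
      using that by (auto simp: Chains_def relation_of_def)
    have chain: "q \<le> r \<or> r \<le> q" if "q \<in> C" "r \<in> C" for q r
      using C that by (auto simp: Chains_def relation_of_def)
    \<comment> \<open>A bound independent of \<open>q\<close>, so the infimum of a nonempty chain is
      finite everywhere.\<close>
    have lower: "- p (- x) \<le> q x" if "q \<in> C" for q x
    proof -
      have "- p (- x) \<le> - q (- x)" using CA[OF that] by (simp add: A_def le_fun_def)
      also have "\<dots> \<le> q x" using CA[OF that] by (intro sublinear_minus) (simp add: A_def)
      finally show ?thesis .
    qed
    show "\<exists>u\<in>A. \<forall>a\<in>C. u \<le> a"
    proof (cases "C = {}")
      case True
      then show ?thesis using p by (auto simp: A_def)
    next
      case False
      define u where "u = (\<lambda>x. INF q\<in>C. q x)"
      have le: "u \<le> q" if "q \<in> C" for q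
        unfolding u_def le_fun_def using lower that
        by (auto intro!: cINF_lower bdd_belowI2)
      have "sublinear u"
        unfolding u_def using False CA lower chain
        by (intro sublinear_Inf_chain[where b = "\<lambda>x. - p (- x)"]) (auto simp: A_def)
      moreover have "u \<le> p"
        using False le CA by (metis (mono_tags, lifting) A_def ex_in_conv mem_Collect_eq order_trans)
      ultimately show ?thesis using le by (auto simp: A_def)
    qed
  qed
  then obtain m where m: "m \<in> A" and min: "\<And>q. q \<in> A \<Longrightarrow> q \<le> m \<Longrightarrow> q = m" by blast
  have "linear m"
  proof (rule minimal_sublinear_linear)
    show "sublinear m" using m by (simp add: A_def)
    show "q = m" if "sublinear q" "q \<le> m" for q
      using min[of q] m that order_trans by (auto simp: A_def)
  qed
  with m show ?thesis by (auto simp: A_def)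
qed

text \<open>Shrinking along \<open>x\<close> before passing to a linear minorant forces
  \<open>f (- x) \<le> - p x\<close>, hence \<open>f x \<ge> p x\<close>.\<close>

lemma ex_supporting_linear:
  assumes p: "sublinear p"
  obtains f where "linear f" "f \<le> p" "f x = p x"
proof -
  obtain q where q: "sublinear q" "q \<le> p" "\<And>y. q y \<le> p (y + x) - p x"
    using sublinear_shrink[OF p] by metis
  obtain f where f: "linear f" "f \<le> q"
    using ex_linear_below_sublinear[OF q(1)] by blast
  have "f \<le> p" using f q by simp
  have "f (- x) \<le> - p x"
    using f(2) q(3)[of "- x"] sublinear_zero[OF p] by (auto simp: le_fun_def intro: order_trans)
  then have "p x \<le> f x" by (simp add: linear_neg[OF f(1)])
  then have "f x = p x" using \<open>f \<le> p\<close> by (simp add: le_fun_def order_antisym)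
  with f \<open>f \<le> p\<close> that show thesis by blast
qed

section \<open>Supporting functionals and local uniform rotundity of a renorming\<close>

lemma is_norm_sublinear: "is_norm N \<Longrightarrow> sublinear N"
  by (simp add: is_norm_def sublinear_def)

lemma is_norm_minus:
  assumes "is_norm N"
  shows "N (- x) = N x"
proof -
  have "N ((- 1) *\<^sub>R x) = \<bar>- 1\<bar> * N x" using assms unfolding is_norm_def by blast
  then show ?thesis by simp
qed

lemma is_norm_diff_commute: "is_norm N \<Longrightarrow> N (x - y) = N (y - x)"
  using is_norm_minus[of N "x - y"] by simp

text \<open>Domination by \<open>N\<close> at \<open>y\<close> and \<open>- y\<close> gives
  \<open>\<bar>f y\<bar> \<le> N y \<le> b * norm y\<close>. Thus \<open>f\<close> is bounded for
  the original norm and is among the functionals that generate the WOT.\<close>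

lemma renorming_supporting_functional:
  fixes N :: "'a::real_normed_vector \<Rightarrow> real"
  assumes "renorming N"
  obtains f :: "'a \<Rightarrow>\<^sub>L real" where "\<And>y. f y \<le> N y" "f x = N x"
proof -
  obtain b where N: "is_norm N" and b: "\<And>x. N x \<le> b * norm x"
    using assms by (auto simp: renorming_def)
  obtain f where f: "linear f" "f \<le> N" "f x = N x"
    using ex_supporting_linear[OF is_norm_sublinear[OF N]] .
  have "norm (f y) \<le> norm y * b" for y
  proof -
    have "f y \<le> N y" "f (- y) \<le> N (- y)" using f by (auto simp: le_fun_def)
    then have "\<bar>f y\<bar> \<le> N y" by (simp add: linear_neg[OF f(1)] is_norm_minus[OF N])
    then show ?thesis using b[of y] by (simp add: mult.commute)
  qed
  then have "bounded_linear f"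
    using f(1) by (intro bounded_linear_intro) (auto simp: linear_add linear_scale)
  then have "blinfun_apply (Blinfun f) = f" by (rule bounded_linear_Blinfun_apply)
  with f that[of "Blinfun f"] show thesis by (auto simp: le_fun_def)
qed

text \<open>If every \<open>d = 1 / (n + 1)\<close> failed, the counterexamples would form a
  sequence contradicting LUR. Restricting to \<open>N y = N x0\<close> suffices for orbits under
  isometries, and the triangle inequality then bounds \<open>N (x0 + y)\<close> from above.\<close>

lemma LUR_at_eps_delta:
  assumes N: "is_norm N" and L: "LUR_at N x0" and e: "0 < e"
  obtains d where "0 < d" "\<And>y. N y = N x0 \<Longrightarrow> 2 * N x0 - d < N (x0 + y) \<Longrightarrow> N (y - x0) < e"
proof (rule ccontr)
  assume contra: "\<not> thesis"
  have "\<exists>y. N y = N x0 \<and> 2 * N x0 - inverse (real (Suc n)) < N (x0 + y) \<and> e \<le> N (y - x0)" for n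
    using contra that[of "inverse (real (Suc n))"] by force
  then obtain y where y: "\<And>n. N (y n) = N x0"
    "\<And>n. 2 * N x0 - inverse (real (Suc n)) < N (x0 + y n)" "\<And>n. e \<le> N (y n - x0)"
    by metis
  have up: "N (x0 + y n) \<le> 2 * N x0" for n
    using sublinear_add[OF is_norm_sublinear[OF N], of x0 "y n"] y(1)[of n] by simp
  have "(\<lambda>n. N (x0 + y n)) \<longlonglongrightarrow> 2 * N x0"
  proof (rule real_tendsto_sandwich)
    show "(\<lambda>n. 2 * N x0 - inverse (real (Suc n))) \<longlonglongrightarrow> 2 * N x0"
      using tendsto_diff[OF tendsto_const LIMSEQ_inverse_real_of_nat, of "2 * N x0"] by simp
    show "(\<lambda>_. 2 * N x0) \<longlonglongrightarrow> 2 * N x0" by (rule tendsto_const)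
    show "\<forall>\<^sub>F n in sequentially. 2 * N x0 - inverse (real (Suc n)) \<le> N (x0 + y n)"
      using y(2) by (intro always_eventually allI less_imp_le)
    show "\<forall>\<^sub>F n in sequentially. N (x0 + y n) \<le> 2 * N x0"
      using up by (intro always_eventually allI)
  qed
  moreover have "(\<lambda>n. N (y n)) \<longlonglongrightarrow> N x0" by (simp add: y)
  ultimately have "(\<lambda>n. N (y n - x0)) \<longlonglongrightarrow> 0" using L by (simp add: LUR_at_def)
  then have "e \<le> 0" by (rule LIMSEQ_le_const) (use y(3) in auto)
  with e show False by simp
qed

section \<open>The weak operator topology and its comparison with the SOT\<close>

lemma openin_weak_operator_topology_functional:
  fixes f :: "'b::real_normed_vector \<Rightarrow>\<^sub>L real" and x :: "'a::real_normed_vector"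
  assumes "open U"
  shows "openin weak_operator_topology {T. blinfun_apply f (blinfun_apply T x) \<in> U}"
  unfolding weak_operator_topology_def
  using assms by (intro topology_generated_by_Basis) fast

lemma topspace_weak_operator_topology: "topspace weak_operator_topology = UNIV"
  using openin_subset[OF openin_weak_operator_topology_functional[of UNIV]] by auto

lemma continuous_map_SOT_WOT: "continuous_map strong_operator_topology weak_operator_topology id"
proof -
  have "openin strong_operator_topology {T. blinfun_apply f (blinfun_apply T x) \<in> U}"
    if "open U" for f :: "'b \<Rightarrow>\<^sub>L real" and x :: 'a and U
  proof -
    have "open (blinfun_apply f -` U)"
      using that by (intro open_vimage) (auto intro: linear_continuous_on blinfun.bounded_linear_right)
    then show ?thesis
      \<comment> \<open>Basic SOT sets constrain the values at finitely many points; the index set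
        \<open>{()}\<close> selects the single point \<open>x\<close>.\<close>
      using strong_operator_topology_basis[of "{()}" "\<lambda>_. blinfun_apply f -` U" "\<lambda>_. x"] by simp
  qed
  \<comment> \<open>The generating sets must cover the whole operator space; \<open>U = UNIV\<close>
    already gives a generator containing every \<open>T\<close>.\<close>
  moreover have "\<exists>V. (\<exists>(f :: 'b \<Rightarrow>\<^sub>L real) (x :: 'a) U.
      V = {T. blinfun_apply f (blinfun_apply T x) \<in> U} \<and> open U) \<and> T \<in> V" for T :: "'a \<Rightarrow>\<^sub>L 'b"
    by (rule exI[of _ UNIV]) (auto intro!: exI[of _ UNIV])
  ultimately show ?thesis
    unfolding weak_operator_topology_def continuous_on_generated_topo_iff
    by (auto simp: strong_operator_topology_topspace)
qed

section \<open>From WOT to SOT on a group of \<open>N\<close>-isometries\<close>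

locale LUR_isometry_group =
  fixes G :: "('a::real_normed_vector \<Rightarrow>\<^sub>L 'a) set" and N :: "'a \<Rightarrow> real"
  assumes subgroup: "subgroup G GL" and renorming: "renorming N"
    and invariant: "invariant_under G N" and LUR: "LUR_on_dense_subset_of_sphere N"
begin

lemma is_norm: "is_norm N"
  using renorming by (simp add: renorming_def)

lemma N_apply: "T \<in> G \<Longrightarrow> N (blinfun_apply T x) = N x"
  using invariant by (simp add: invariant_under_def)

lemma N_triangle: "N (x + y) \<le> N x + N y"
  using is_norm by (simp add: is_norm_def)

lemma surj_apply:
  assumes "T \<in> G"
  obtains z where "blinfun_apply T z = y"
proof -
  have "T \<in> carrier GL" using assms subgroup subgroup.subset by blast
  then obtain S where "T o\<^sub>L S = id_blinfun" by (auto simp: GL_def)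
  then have "blinfun_apply T (blinfun_apply S y) = y"
    by (metis blinfun_apply_blinfun_compose blinfun_apply_id_blinfun id_apply)
  then show thesis by (rule that)
qed

lemma WOT_neighbourhood_LUR:
  assumes T0: "T0 \<in> G" and x: "N x = 1" "LUR_at N x" and e: "0 < e"
  obtains U where "openin weak_operator_topology U" "T0 \<in> U"
    "\<And>T. T \<in> U \<Longrightarrow> T \<in> G \<Longrightarrow> N (blinfun_apply T x - blinfun_apply T0 x) < e"
proof -
  obtain d where d: "0 < d" "\<And>y. N y = 1 \<Longrightarrow> 2 - d < N (x + y) \<Longrightarrow> N (y - x) < e"
    using LUR_at_eps_delta[OF is_norm x(2) e] unfolding x(1) by auto
  obtain f :: "'a \<Rightarrow>\<^sub>L real" where f: "\<And>y. f y \<le> N y" "f (T0 x) = N (T0 x)"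
    using renorming_supporting_functional[OF renorming, where x = "T0 x"] by blast
  have f1: "f (T0 x) = 1" by (simp add: f(2) N_apply T0 x)
  show thesis
  proof
    \<comment> \<open>One functional and one half-line suffice: since \<open>f (T0 x) = 1\<close>,
      membership gives \<open>f (T0 x + T x) > 2 - d\<close>.\<close>
    show "openin weak_operator_topology {T. blinfun_apply f (blinfun_apply T x) \<in> {1 - d<..}}"
      by (intro openin_weak_operator_topology_functional) simp
    show "T0 \<in> {T. blinfun_apply f (blinfun_apply T x) \<in> {1 - d<..}}" using d f1 by simp
  next
    fix T assume T: "T \<in> G" and near: "T \<in> {T. blinfun_apply f (blinfun_apply T x) \<in> {1 - d<..}}"
    \<comment> \<open>Here \<open>z\<close> stands for the inverse of \<open>T0\<close> applied to
      \<open>T x\<close>; it lies on the unit sphere of \<open>N\<close>, so LUR at the fixed point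
      \<open>x\<close> can be applied to it.\<close>
    obtain z where z: "T0 z = T x" using surj_apply[OF T0] .
    have "N z = 1" using N_apply[OF T0, of z] N_apply[OF T, of x] x z by simp
    moreover have "2 - d < N (x + z)"
    proof -
      have "2 - d < f (T0 x + T x)" using near f1 by (simp add: blinfun.add_right)
      also have "\<dots> \<le> N (T0 (x + z))" using f(1)[of "T0 x + T x"] z by (simp add: blinfun.add_right)
      finally show ?thesis by (simp add: N_apply T0)
    qed
    ultimately have "N (z - x) < e" by (rule d)
    then show "N (T x - T0 x) < e" using N_apply[OF T0, of "z - x"] z by (simp add: blinfun.diff_right)
  qed
qed

text \<open>A three-term estimate: all members of \<open>G\<close> are isometric for
  \<open>N\<close>, so replacing \<open>x\<close> by a nearby LUR point \<open>y\<close> costs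
  \<open>N (y - x)\<close> once for \<open>T\<close> and once for \<open>T0\<close>, uniformly in
  \<open>T\<close>.\<close>

lemma WOT_neighbourhood_unit:
  assumes T0: "T0 \<in> G" and x: "N x = 1" and e: "0 < e"
  obtains U where "openin weak_operator_topology U" "T0 \<in> U"
    "\<And>T. T \<in> U \<Longrightarrow> T \<in> G \<Longrightarrow> N (blinfun_apply T x - blinfun_apply T0 x) < e"
proof -
  obtain D where D: "D \<subseteq> unit_sphere N" "unit_sphere N \<subseteq> closure D" "\<And>x. x \<in> D \<Longrightarrow> LUR_at N x"
    using LUR by (auto simp: LUR_on_dense_subset_of_sphere_def)
  obtain b where b: "b > 0" "\<And>x. N x \<le> b * norm x"
    using renorming by (auto simp: renorming_def)
  have "x \<in> closure D" using D x by (auto simp: unit_sphere_def)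
  \<comment> \<open>The factor \<open>b\<close> converts closeness in the original norm, used for
    the closure, into \<open>N (y - x) < e / 3\<close>.\<close>
  then obtain y where y: "y \<in> D" "dist y x < e / (3 * b)"
    using e b by (metis closure_approachable divide_pos_pos mult_pos_pos zero_less_numeral)
  have "N (y - x) \<le> b * norm (y - x)" by (rule b)
  also have "\<dots> < e / 3" using y b by (simp add: dist_norm field_simps)
  finally have yx: "N (y - x) < e / 3" .
  obtain U where U: "openin weak_operator_topology U" "T0 \<in> U"
    "\<And>T. T \<in> U \<Longrightarrow> T \<in> G \<Longrightarrow> N (blinfun_apply T y - blinfun_apply T0 y) < e / 3"
    using WOT_neighbourhood_LUR[OF T0, of y "e / 3"] D y e by (auto simp: unit_sphere_def)
  have "N (T x - T0 x) < e" if T: "T \<in> U" "T \<in> G" for T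
  proof -
    have "T x - T0 x = T (x - y) + ((T y - T0 y) + T0 (y - x))"
      by (simp add: blinfun.diff_right)
    then have "N (T x - T0 x) \<le> N (T (x - y)) + (N (T y - T0 y) + N (T0 (y - x)))"
      by (metis N_triangle add_left_mono order_trans)
    also have "\<dots> = N (y - x) + (N (T y - T0 y) + N (y - x))"
      by (simp add: N_apply T T0 is_norm_diff_commute[OF is_norm])
    finally show ?thesis using yx U(3)[OF T] by simp
  qed
  with U that show thesis by blast
qed

text \<open>Normalising a nonzero \<open>x\<close> reduces to the unit sphere. The tolerance
  \<open>a * e / N x\<close> becomes \<open>a * e\<close> after rescaling, and
  \<open>a * norm y \<le> N y\<close> turns this into \<open>e\<close> for the original
  norm.\<close>

lemma WOT_neighbourhood:
  assumes T0: "T0 \<in> G" and e: "0 < e"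
  shows "\<exists>U. openin weak_operator_topology U \<and> T0 \<in> U \<and>
    (\<forall>T\<in>U \<inter> G. norm (blinfun_apply T x - blinfun_apply T0 x) < e)"
proof (cases "x = 0")
  case True
  then show ?thesis
    using e openin_topspace[of weak_operator_topology]
    by (intro exI[of _ UNIV]) (simp add: topspace_weak_operator_topology)
next
  case False
  obtain a where a: "a > 0" "\<And>x. a * norm x \<le> N x"
    using renorming by (auto simp: renorming_def)
  have Nx: "N x > 0" using False is_norm by (metis is_norm_def less_eq_real_def)
  have scale: "N (c *\<^sub>R y) = \<bar>c\<bar> * N y" for c y using is_norm by (simp add: is_norm_def)
  obtain U where U: "openin weak_operator_topology U" "T0 \<in> U"
    "\<And>T. T \<in> U \<Longrightarrow> T \<in> G \<Longrightarrow>
      N (blinfun_apply T (inverse (N x) *\<^sub>R x) - blinfun_apply T0 (inverse (N x) *\<^sub>R x)) < a * e / N x"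
    using WOT_neighbourhood_unit[OF T0, of "inverse (N x) *\<^sub>R x" "a * e / N x"] Nx a e
    by (auto simp: scale)
  have "norm (T x - T0 x) < e" if T: "T \<in> U" "T \<in> G" for T
  proof -
    have "N (T x - T0 x) / N x < a * e / N x"
      using U(3)[OF T] Nx
      by (simp add: blinfun.scaleR_right scale divide_inverse mult.commute flip: scaleR_diff_right)
    then have "N (T x - T0 x) < a * e" using Nx by (simp add: divide_less_cancel)
    then have "a * norm (T x - T0 x) < a * e" using a(2) by (rule le_less_trans[rotated])
    then show ?thesis using a by simp
  qed
  with U show ?thesis by blast
qed

text \<open>Continuity into the SOT can be tested on each orbit map \<open>T \<mapsto> T x\<close>,
  so neighbourhoods for one vector at a time are enough.\<close>

lemma continuous_map_WOT_SOT:
  "continuous_map (subtopology weak_operator_topology G) strong_operator_topology id"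
  unfolding continuous_on_strong_operator_topo_iff_coordinatewise
proof
  fix x
  have "\<exists>U. openin (subtopology weak_operator_topology G) U \<and> T0 \<in> U \<and>
      (\<forall>T\<in>U. dist (blinfun_apply T0 x) (blinfun_apply T x) < e)"
    if T0: "T0 \<in> G" and e: "0 < e" for T0 e
  proof -
    obtain U where "openin weak_operator_topology U" "T0 \<in> U"
      "\<forall>T\<in>U \<inter> G. norm (blinfun_apply T x - blinfun_apply T0 x) < e"
      using WOT_neighbourhood[OF T0 e] by blast
    with T0 show ?thesis
      by (intro exI[of _ "U \<inter> G"])
        (auto simp: openin_subtopology dist_norm norm_minus_commute)
  qed
  then show "continuous_map (subtopology weak_operator_topology G) euclidean
      (\<lambda>T. blinfun_apply (id T) x)"
    using Met_TC.continuous_map_to_metric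
      [of "subtopology weak_operator_topology G" "\<lambda>T. blinfun_apply T x"]
    by (simp add: topspace_weak_operator_topology)
qed

lemma light: "light G"
  unfolding light_def
proof -
  let ?W = "subtopology weak_operator_topology G" and ?S = "subtopology strong_operator_topology G"
  have top: "topspace ?W = G" "topspace ?S = G"
    by (simp_all add: topspace_weak_operator_topology strong_operator_topology_topspace)
  have "continuous_map ?W ?S id"
    using continuous_map_WOT_SOT top by (simp add: continuous_map_in_subtopology)
  moreover have "continuous_map ?S ?W id"
    using continuous_map_from_subtopology[OF continuous_map_SOT_WOT, of G] top
    by (simp add: continuous_map_in_subtopology)
  ultimately show "?W = ?S"
    \<comment> \<open>On the common underlying set \<open>G\<close>, continuity of the identity in
      each direction says that each topology refines the other.\<close>
    using topology_finer_continuous_id top topology_eq by metis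
qed

end

theorem theorem2p3:
  fixes G :: "('a::banach \<Rightarrow>\<^sub>L 'a) set"
  assumes "subgroup G GL"
    and "\<exists>N. renorming N \<and> invariant_under G N \<and> LUR_on_dense_subset_of_sphere N"
  shows "light G"
proof -
  obtain N where "renorming N" "invariant_under G N" "LUR_on_dense_subset_of_sphere N"
    using assms(2) by blast
  with assms(1) interpret LUR_isometry_group G N by (rule LUR_isometry_group.intro)
  show ?thesis by (rule light)
qed

end
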